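(* Let $N\ge1$. There exists $C=C(N)>0$ such that $$C^{-1}\underline{H}(x,y,t)\le H(x,y,t)\le C\,\overline{H}(x,y,t)$$ for all $(x,y,t)\in D:=\overline{\Omega}\times\overline{\Omega}\times(0,\infty)$, where $$\overline{H}(x,y,t):=\begin{cases}P_N(x-y^*,t), & (x,y,t)\in D_1,\\ \Gamma_N(x-y^*,t), & (x,y,t)\in D_2\cup D_4,\\ (x_N+y_N+t)\,\Gamma_N(x-y^*,t), & (x,y,t)\in D_3,\end{cases}$$ $$\underline{H}(x,y,t):=\begin{cases}P_N(x-y^*,t), & (x,y,t)\in D_1,\\ \Gamma_N\left(x-y^*,\frac t2\right), & (x,y,t)\in D_2\cup D_4,\\ (x_N+y_N+t)\,\Gamma_N\left(x-y^*,\frac t2\right), & (x,y,t)\in D_3,\end{cases}$$ and $$\begin{aligned} D_1&:=\{(x,y,t)\in D: |x-y^*|^2<2(N+2)t,\ t<4(N+2)\},\\ D_2&:=\{(x,y,t)\in D: |x-y^*|^2<2(N+2)t,\ t\ge4(N+2)\},\\ D_3&:=\{(x,y,t)\in D: |x-y^*|^2\ge2(N+2)t,\ x_N+y_N+t<1\},\\ D_4&:=\{(x,y,t)\in D: |x-y^*|^2\ge2(N+2)t,\ x_N+y_N+t\ge1\}. \end{aligned}$$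
   Context: $N\ge1$ is an integer and $\Omega:=\{x=(x',x_N)\in\mathbb R^N: x'\in\mathbb R^{N-1},\ x_N\in(0,\infty)\}$ ($\Omega=(0,\infty)$ if $N=1$). For $y=(y',y_N)\in\overline\Omega$, $y^*=(y',-y_N)$. $e_N=(0,\dots,0,1)\in\mathbb R^N$. $\Gamma_N(x,t):=(4\pi t)^{-N/2}e^{-|x|^2/(4t)}$ for $(x,t)\in\mathbb R^N\times(0,\infty)$. The function $H$ is defined by $$H(x,y,t):=-2\int_0^t (\partial_{x_N}\Gamma_N)(x-y^*+\tau e_N,t-\tau)\,d\tau,\qquad (x,y,t)\in D.$$ The kernel $P_N$ is given by $P_N(x,t):=c_N(x_N+t)|x+te_N|^{-N}$ if $N\ge2$ and $P_N(x,t):=1$ if $N=1$, for $x=(x',x_N)\in\overline\Omega$ and $t>0$, where for $N\ge2$ the constant $c_N>0$ is chosen so that $\int_{\mathbb R^{N-1}}c_N x_N|(x',x_N)|^{-N}\,dx'=1$ for all $x_N>0$. *)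

theory Defs
  imports "HOL-Analysis.Analysis"
begin

text \<open>
  Points of \<open>\<real>\<^sup>N\<close>, \<open>N \<ge> 1\<close>, are vectors of type \<open>real ^ 'n\<close> with \<open>N = CARD('n)\<close>. The index type is
  linearly ordered so that there is a last coordinate, playing the role of \<open>x\<^sub>N\<close>.
\<close>

definition last_ix :: "'n::{finite,linorder}" where
  "last_ix = Max UNIV"

abbreviation lastc :: "real ^ 'n::{finite,linorder} \<Rightarrow> real" where
  "lastc x \<equiv> x $ last_ix"

definition e_last :: "real ^ 'n::{finite,linorder}" where
  "e_last = axis last_ix 1"

definition Omega :: "(real ^ 'n::{finite,linorder}) set" where
  "Omega = {x. 0 < lastc x}"

definition reflect :: "real ^ 'n::{finite,linorder} \<Rightarrow> real ^ 'n::{finite,linorder}" where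
  "reflect y = (\<chi> i. if i = last_ix then - y $ i else y $ i)"

definition heat_kernel :: "real ^ 'n::{finite,linorder} \<Rightarrow> real \<Rightarrow> real" where
  "heat_kernel x t =
     (4 * pi * t) powr (- real CARD('n) / 2) * exp (- (norm x)\<^sup>2 / (4 * t))"

definition partial_last ::
  "(real ^ 'n::{finite,linorder} \<Rightarrow> real \<Rightarrow> real) \<Rightarrow> real ^ 'n::{finite,linorder} \<Rightarrow> real \<Rightarrow> real" where
  "partial_last f x t = deriv (\<lambda>h. f (x + h *\<^sub>R e_last) t) 0"

definition H :: "real ^ 'n::{finite,linorder} \<Rightarrow> real ^ 'n::{finite,linorder} \<Rightarrow> real \<Rightarrow> real" where
  "H x y t =
     - 2 * (LBINT \<tau>:{0<..<t}. partial_last heat_kernel (x - reflect y + \<tau> *\<^sub>R e_last) (t - \<tau>))"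

text \<open>
  The vector \<open>(x', s)\<close>. A point \<open>x' \<in> \<real>\<^bsup>N-1\<^esup>\<close> is a function on the indices other than the last one,
  and \<open>dx'\<close> is the corresponding product Lebesgue measure.
\<close>

definition join_last :: "('n \<Rightarrow> real) \<Rightarrow> real \<Rightarrow> real ^ 'n::{finite,linorder}" where
  "join_last x' s = (\<chi> i. if i = last_ix then s else x' i)"

text \<open>The normalising constant \<open>c\<^sub>N\<close>; it is only meaningful, and only used, for \<open>N \<ge> 2\<close>.\<close>

definition poisson_const :: "'n::{finite,linorder} itself \<Rightarrow> real" where
  "poisson_const _ =
     (THE c. 0 < c \<and>
        (\<forall>s>0. (LINT x'|Pi\<^sub>M (UNIV - {last_ix :: 'n}) (\<lambda>_. lborel).
                  c * s / norm (join_last x' s :: real ^ 'n::{finite,linorder}) ^ CARD('n)) = 1))"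

definition poisson_kernel :: "real ^ 'n::{finite,linorder} \<Rightarrow> real \<Rightarrow> real" where
  "poisson_kernel x t =
     (if CARD('n) = 1 then 1
      else poisson_const TYPE('n) * (lastc x + t) / norm (x + t *\<^sub>R e_last) ^ CARD('n))"

definition D :: "((real ^ 'n::{finite,linorder}) \<times> (real ^ 'n::{finite,linorder}) \<times> real) set" where
  "D = closure Omega \<times> closure Omega \<times> {0<..}"

definition D1 :: "((real ^ 'n::{finite,linorder}) \<times> (real ^ 'n::{finite,linorder}) \<times> real) set" where
  "D1 = {(x, y, t) \<in> D. (norm (x - reflect y))\<^sup>2 < 2 * (real CARD('n) + 2) * t
                        \<and> t < 4 * (real CARD('n) + 2)}"

definition D2 :: "((real ^ 'n::{finite,linorder}) \<times> (real ^ 'n::{finite,linorder}) \<times> real) set" where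
  "D2 = {(x, y, t) \<in> D. (norm (x - reflect y))\<^sup>2 < 2 * (real CARD('n) + 2) * t
                        \<and> t \<ge> 4 * (real CARD('n) + 2)}"

definition D3 :: "((real ^ 'n::{finite,linorder}) \<times> (real ^ 'n::{finite,linorder}) \<times> real) set" where
  "D3 = {(x, y, t) \<in> D. (norm (x - reflect y))\<^sup>2 \<ge> 2 * (real CARD('n) + 2) * t
                        \<and> lastc x + lastc y + t < 1}"

definition D4 :: "((real ^ 'n::{finite,linorder}) \<times> (real ^ 'n::{finite,linorder}) \<times> real) set" where
  "D4 = {(x, y, t) \<in> D. (norm (x - reflect y))\<^sup>2 \<ge> 2 * (real CARD('n) + 2) * t
                        \<and> lastc x + lastc y + t \<ge> 1}"

text \<open>\<open>D1\<close>, \<open>D2\<close>, \<open>D3\<close>, \<open>D4\<close> partition \<open>D\<close>, so the order of the cases is immaterial.\<close>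

definition H_upper :: "real ^ 'n::{finite,linorder} \<Rightarrow> real ^ 'n::{finite,linorder} \<Rightarrow> real \<Rightarrow> real" where
  "H_upper x y t =
     (if (x, y, t) \<in> D1 then poisson_kernel (x - reflect y) t
      else if (x, y, t) \<in> D2 \<union> D4 then heat_kernel (x - reflect y) t
      else if (x, y, t) \<in> D3 then (lastc x + lastc y + t) * heat_kernel (x - reflect y) t
      else undefined)"

definition H_lower :: "real ^ 'n::{finite,linorder} \<Rightarrow> real ^ 'n::{finite,linorder} \<Rightarrow> real \<Rightarrow> real" where
  "H_lower x y t =
     (if (x, y, t) \<in> D1 then poisson_kernel (x - reflect y) t
      else if (x, y, t) \<in> D2 \<union> D4 then heat_kernel (x - reflect y) (t / 2)
      else if (x, y, t) \<in> D3 then (lastc x + lastc y + t) * heat_kernel (x - reflect y) (t / 2)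
      else undefined)"

end

theory Submission
  imports Defs
begin

text \<open>
  With \<open>z = x - y\<^sup>*\<close>, \<open>a = z\<^sub>N\<close>, \<open>w = \<bar>z'\<bar>\<^sup>2\<close> and \<open>q = N/2 + 1\<close>, \<open>H\<close> is a constant multiple of
  the integral of \<open>(a + \<tau>) * (t - \<tau>) powr (- q) * exp (- (w + (a + \<tau>)\<^sup>2) / (4 * (t - \<tau>)))\<close> over
  \<open>0 < \<tau> < t\<close>. Each upper bound dominates the integrand by an explicit derivative. Far from the
  origin (\<open>D\<^sub>3\<close>, \<open>D\<^sub>4\<close>) this works because \<open>s powr (- q) * exp (- \<bar>z\<bar>\<^sup>2 / (4 * s))\<close> increases on \<open>(0, t]\<close>
  when \<open>4 * q * t \<le> \<bar>z\<bar>\<^sup>2\<close>. Each lower bound keeps only the subinterval carrying the mass: on \<open>D\<^sub>1\<close>,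
  \<open>t - \<tau>\<close> comparable to \<open>\<bar>z + t e\<^sub>N\<bar>\<^sup>2\<close>; on \<open>D\<^sub>3\<close>, \<open>\<tau>\<close> comparable to \<open>t\<close>; on \<open>D\<^sub>2\<close> and \<open>D\<^sub>4\<close>,
  \<open>\<tau>\<close> comparable to \<open>t / (a + \<surd>t)\<close>.
\<close>

subsection \<open>The normalising constant of the Poisson kernel\<close>

text \<open>Since \<open>(1 + |x|)^2 <= 2 (1 + x^2)\<close>, the function is dominated by
  \<open>f |x|\<close>, whose antiderivative \<open>G\<close> vanishes at infinity because
  \<open>2 p > 1\<close>. The negative half-line follows by reflection.\<close>

lemma integrable_inverse_one_plus_square_powr:
  fixes p :: real
  assumes "p > 1/2"
  shows "integrable lborel (\<lambda>x::real. (1 + x\<^sup>2) powr (-p))"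
proof -
  define f where "f = (\<lambda>x::real. 2 powr p * (1 + x) powr (-(2*p)))"
  define G where "G = (\<lambda>x::real. - (2 powr p / (2*p-1)) * (1 + x) powr (1-2*p))"
  have [measurable]: "f \<in> borel_measurable borel" unfolding f_def by measurable
  have lim: "(G \<longlongrightarrow> - (2 powr p / (2*p-1)) * 0) at_top"
    unfolding G_def
    by (intro tendsto_mult tendsto_const tendsto_neg_powr filterlim_tendsto_add_at_top[OF tendsto_const] filterlim_ident)
       (use assms in auto)
  have der: "(G has_real_derivative f x) (at x)" if "0 \<le> x" for x
    unfolding G_def f_def
    by (rule derivative_eq_intros refl | use that assms in \<open>simp add: field_simps\<close>)+
  have "(\<integral>\<^sup>+x. ennreal (f x) * indicator {0..} x \<partial>lborel) = ennreal (0 - G 0)"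
    by (rule nn_integral_FTC_atLeast) (use lim der in \<open>auto simp: f_def\<close>)
  then have "(\<integral>\<^sup>+x. ennreal (f x * indicator {0..} x) \<partial>lborel) < \<infinity>"
    by (simp add: ennreal_mult'' ennreal_indicator)
  then have 1: "integrable lborel (\<lambda>x. f x * indicator {0..} x)"
    by (intro integrableI_nonneg) (auto simp: f_def)
  then have 2: "integrable lborel (\<lambda>x. f (0 + (-1)*x) * indicator {0..} (0 + (-1)*x))"
    by (rule lborel_integrable_real_affine) simp
  show ?thesis
  proof (rule Bochner_Integration.integrable_bound[OF Bochner_Integration.integrable_add[OF 1 2]])
    have "(1 + x\<^sup>2) powr (-p) \<le> f \<bar>x\<bar>" for x :: real
    proof -
      have "0 \<le> (1 - \<bar>x\<bar>)\<^sup>2" by simp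
      then have "(1 + \<bar>x\<bar>)\<^sup>2 / 2 \<le> 1 + x\<^sup>2" by (simp add: power2_eq_square field_simps)
      then have "(1 + x\<^sup>2) powr (-p) \<le> ((1 + \<bar>x\<bar>)\<^sup>2 / 2) powr (-p)"
        by (intro powr_mono2') (use assms in auto)
      also have "(1 + \<bar>x\<bar>)\<^sup>2 = (1 + \<bar>x\<bar>) powr 2"
        by simp
      also have "((1 + \<bar>x\<bar>) powr 2 / 2) powr (-p) = f \<bar>x\<bar>"
        unfolding f_def by (simp add: powr_divide powr_powr powr_minus field_simps del: powr_numeral)
      finally show ?thesis .
    qed
    moreover have "f x \<ge> 0" for x
      by (simp add: f_def)
    ultimately have "(1 + x\<^sup>2) powr - p
      \<le> f x * indicator {0..} x + f (0 + - 1 * x) * indicator {0..} (0 + - 1 * x)" for x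
      by (cases "0 \<le> x") (auto simp: add_increasing2 split: split_indicator dest!: meta_spec[of _ x])
    then show "AE x in lborel. norm ((1 + x\<^sup>2) powr - p)
      \<le> norm (f x * indicator {0..} x + f (0 + - 1 * x) * indicator {0..} (0 + - 1 * x))"
      by (intro AE_I2) (metis abs_ge_self abs_of_nonneg order_trans powr_ge_zero real_norm_def)
  qed simp
qed

text \<open>Induction on \<open>I\<close>: one coordinate is split off by Tonelli and contributes a
  factor \<open>c\<close> through the one-dimensional substitution. This is what makes the
  normalising integral of the Poisson kernel independent of the height \<open>s\<close>.\<close>

lemma nn_integral_PiM_lborel_scale:
  fixes c :: real and f :: "('i \<Rightarrow> real) \<Rightarrow> ennreal"
  assumes "finite I" "c > 0" "f \<in> borel_measurable (Pi\<^sub>M I (\<lambda>_. lborel))"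
  shows "(\<integral>\<^sup>+x. f x \<partial>Pi\<^sub>M I (\<lambda>_. lborel)) =
    ennreal c ^ card I * (\<integral>\<^sup>+x. f (\<lambda>i\<in>I. c * x i) \<partial>Pi\<^sub>M I (\<lambda>_. lborel))"
  using assms(1,3)
proof (induction I arbitrary: f rule: finite_induct)
  case empty
  have "(\<integral>\<^sup>+x. f x \<partial>Pi\<^sub>M {} (\<lambda>_. lborel)) = (\<integral>\<^sup>+x. f (\<lambda>i\<in>{}. c * x i) \<partial>Pi\<^sub>M {} (\<lambda>_. lborel))"
  proof (rule nn_integral_cong)
    fix x assume "x \<in> space (Pi\<^sub>M {} (\<lambda>_::'i. lborel :: real measure))"
    \<comment> \<open>The product space over the empty set has the everywhere undefined function as
      its only point.\<close>
    then have "x = (\<lambda>i\<in>{}. c * x i)" by (auto simp: space_PiM)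
    then show "f x = f (\<lambda>i\<in>{}. c * x i)" by simp
  qed
  then show ?case by (simp only: card.empty power_0 mult_1)
next
  case (insert i I)
  interpret product_sigma_finite "\<lambda>_. lborel :: real measure" ..
  let ?M = "\<lambda>I. Pi\<^sub>M I (\<lambda>_::'i. lborel :: real measure)"
  note [measurable] = insert.prems
  have [measurable]: "(\<lambda>x. f (\<lambda>j\<in>insert i I. c * x j)) \<in> borel_measurable (?M (insert i I))"
    by measurable
  have "(\<integral>\<^sup>+x. f x \<partial>?M (insert i I)) = (\<integral>\<^sup>+x. (\<integral>\<^sup>+y. f (x(i:=y)) \<partial>lborel) \<partial>?M I)"
    by (rule product_nn_integral_insert) (use insert in auto)
  also have "\<dots> = (\<integral>\<^sup>+x. ennreal c * (\<integral>\<^sup>+y. f (x(i:=c*y)) \<partial>lborel) \<partial>?M I)"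
  proof (intro nn_integral_cong)
    fix x assume [measurable]: "x \<in> space (?M I)"
    have [measurable]: "(\<lambda>y. f (x(i:=y))) \<in> borel_measurable borel"
      by measurable
    show "(\<integral>\<^sup>+y. f (x(i:=y)) \<partial>lborel) = ennreal c * (\<integral>\<^sup>+y. f (x(i:=c*y)) \<partial>lborel)"
      using \<open>c > 0\<close> by (subst nn_integral_real_affine[where c=c and t=0]) auto
  qed
  also have "\<dots> = ennreal c * (\<integral>\<^sup>+x. (\<integral>\<^sup>+y. f (x(i:=c*y)) \<partial>lborel) \<partial>?M I)"
    by (rule nn_integral_cmult) measurable
  also have "(\<integral>\<^sup>+x. (\<integral>\<^sup>+y. f (x(i:=c*y)) \<partial>lborel) \<partial>?M I) =
     ennreal c ^ card I * (\<integral>\<^sup>+x. (\<integral>\<^sup>+y. f ((\<lambda>j\<in>I. c * x j)(i:=c*y)) \<partial>lborel) \<partial>?M I)"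
    by (rule insert.IH) measurable
  also have "(\<integral>\<^sup>+x. (\<integral>\<^sup>+y. f ((\<lambda>j\<in>I. c * x j)(i:=c*y)) \<partial>lborel) \<partial>?M I) =
     (\<integral>\<^sup>+x. (\<integral>\<^sup>+y. f (\<lambda>j\<in>insert i I. c * (x(i:=y)) j) \<partial>lborel) \<partial>?M I)"
    by (intro nn_integral_cong arg_cong[of _ _ f]) (use insert.hyps in \<open>auto simp: fun_eq_iff\<close>)
  also have "\<dots> = (\<integral>\<^sup>+x. f (\<lambda>j\<in>insert i I. c * x j) \<partial>?M (insert i I))"
    by (rule product_nn_integral_insert[symmetric]) (use insert in auto)
  finally show ?case
    unfolding card_insert_disjoint[OF insert.hyps] power_Suc mult.assoc .
qed

lemma norm_join_last:
  "(norm (join_last x' s :: real ^ 'n::{finite,linorder}))\<^sup>2 = s\<^sup>2 + (\<Sum>i\<in>UNIV - {last_ix::'n::{finite,linorder}}. (x' i)\<^sup>2)"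
proof -
  have "(norm (join_last x' s :: real ^ 'n::{finite,linorder}))\<^sup>2 = (\<Sum>i\<in>UNIV. ((join_last x' s :: real ^ 'n::{finite,linorder}) $ i)\<^sup>2)"
    by (simp add: norm_vec_def L2_set_def sum_nonneg)
  also have "\<dots> = s\<^sup>2 + (\<Sum>i\<in>UNIV - {last_ix}. ((join_last x' s :: real ^ 'n::{finite,linorder}) $ i)\<^sup>2)"
    by (subst sum.remove[of _ last_ix]) (auto simp: join_last_def)
  also have "\<dots> = s\<^sup>2 + (\<Sum>i\<in>UNIV - {last_ix}. (x' i)\<^sup>2)"
    by (intro arg_cong2[of _ _ _ _ "(+)"] sum.cong) (auto simp: join_last_def)
  finally show ?thesis .
qed

lemma norm_join_last_power:
  fixes s :: real
  assumes "s \<noteq> 0"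
  shows "norm (join_last x' s :: real ^ 'n::{finite,linorder}) ^ CARD('n::{finite,linorder})
    = (s\<^sup>2 + (\<Sum>i\<in>UNIV - {last_ix::'n::{finite,linorder}}. (x' i)\<^sup>2)) powr (real CARD('n::{finite,linorder}) / 2)"
proof -
  have "join_last x' s \<noteq> (0 :: real ^ 'n::{finite,linorder})"
    using assms by (auto simp: join_last_def vec_eq_iff)
  then have "norm (join_last x' s :: real ^ 'n::{finite,linorder}) > 0" by simp
  then show ?thesis
    unfolding norm_join_last[symmetric]
    by (simp add: powr_realpow[symmetric] powr_powr del: powr_numeral powr_realpow)
qed

text \<open>The maximum of the numbers \<open>1 + x\<^sub>i\<^sup>2\<close> dominates their geometric mean, which reduces the
  integrability of \<open>(1 + \<bar>x'\<bar>\<^sup>2) powr (- N / 2)\<close> to dimension one.\<close>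

lemma integrable_one_plus_sum_squares_powr:
  fixes I :: "'i set" and p :: real
  assumes "finite I" "I \<noteq> {}" "p > real (card I) / 2"
  shows "integrable (Pi\<^sub>M I (\<lambda>_. lborel)) (\<lambda>x. (1 + (\<Sum>i\<in>I. (x i)\<^sup>2)) powr (-p))"
proof -
  interpret product_sigma_finite "\<lambda>_. lborel :: real measure" ..
  have n: "card I > 0" using assms by (simp add: card_gt_0_iff)
  let ?q = "p / card I"
  have "integrable (Pi\<^sub>M I (\<lambda>_. lborel)) (\<lambda>x. \<Prod>i\<in>I. (1 + (x i)\<^sup>2) powr (- ?q))"
    using assms n
    by (intro product_integrable_prod integrable_inverse_one_plus_square_powr) (auto simp: field_simps)
  then show ?thesis
  proof (rule Bochner_Integration.integrable_bound)
    have "(1 + (\<Sum>i\<in>I. (x i)\<^sup>2)) powr (-p) \<le> (\<Prod>i\<in>I. (1 + (x i)\<^sup>2) powr (- ?q))" for x :: "'i \<Rightarrow> real"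
    proof -
      let ?S = "1 + (\<Sum>i\<in>I. (x i)\<^sup>2)"
      have S: "?S > 0" by (intro add_pos_nonneg sum_nonneg) auto
      have "?S powr (-p) = (\<Prod>i\<in>I. ?S powr (- ?q))"
        using n S by (simp add: powr_power)
      also have "\<dots> \<le> (\<Prod>i\<in>I. (1 + (x i)\<^sup>2) powr (- ?q))"
      proof (intro prod_mono conjI powr_mono2' add_left_mono member_le_sum)
        show "- ?q \<le> 0" using assms n by (simp add: field_simps)
      qed (use assms in \<open>auto intro: add_pos_nonneg\<close>)
      finally show ?thesis .
    qed
    then show "AE x in Pi\<^sub>M I (\<lambda>_. lborel). norm ((1 + (\<Sum>i\<in>I. (x i)\<^sup>2)) powr (-p))
        \<le> norm (\<Prod>i\<in>I. (1 + (x i)\<^sup>2) powr (- ?q))"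
      by (simp add: prod_nonneg)
  qed measurable
qed

text \<open>\<open>THE\<close> yields a known number only if the normalisation determines
  \<open>c\<close>. Scaling turns the integral at height \<open>s\<close> into \<open>c\<close>
  times a fixed \<open>B > 0\<close>, so the unique solution is \<open>1 / B\<close>.\<close>

lemma poisson_const_pos:
  assumes "CARD('n::{finite,linorder}) \<noteq> 1"
  shows "poisson_const TYPE('n::{finite,linorder}) > 0"
proof -
  define J where "J = UNIV - {last_ix :: 'n}"
  define \<mu> where "\<mu> = Pi\<^sub>M J (\<lambda>_. lborel :: real measure)"
  define S where "S = (\<lambda>s x. (s\<^sup>2 + (\<Sum>i\<in>J. (x i :: real)\<^sup>2)))"
  define p where "p = real CARD('n) / 2"
  have "CARD('n) \<noteq> 0" by simp
  with assms have N: "CARD('n) \<ge> 2" by linarith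
  have J: "finite J" "card J = CARD('n) - 1"
    by (auto simp: J_def card_Diff_singleton)
  with N have "J \<noteq> {}" by auto
  have [measurable]: "S s \<in> borel_measurable \<mu>" for s
    unfolding S_def \<mu>_def by measurable
  have Spos: "S s x > 0" if "s > 0" for s x
    unfolding S_def by (intro add_pos_nonneg sum_nonneg) (use that in auto)
  have int1: "integrable \<mu> (\<lambda>x. S 1 x powr (-p))"
    using integrable_one_plus_sum_squares_powr[of J p] J N \<open>J \<noteq> {}\<close> by (simp add: S_def \<mu>_def p_def)
  define B where "B = (LINT x|\<mu>. S 1 x powr (-p))"
  \<comment> \<open>A positive integrable function has a nonzero integral only over a space that is
    not null.\<close>
  have nz: "emeasure \<mu> (space \<mu>) \<noteq> 0"
  proof -
    interpret product_sigma_finite "\<lambda>_. lborel :: real measure" ..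
    have "emeasure \<mu> (space \<mu>) = (\<Prod>i\<in>J. emeasure lborel (UNIV :: real set))"
      unfolding \<mu>_def using J by (simp only: space_PiM space_lborel) (subst emeasure_PiM, auto)
    then show ?thesis by (simp add: power_eq_0_iff)
  qed
  have "\<not> (AE x in \<mu>. S 1 x powr (-p) = 0)"
  proof
    assume "AE x in \<mu>. S 1 x powr (-p) = 0"
    then have "AE x in \<mu>. False" using Spos[of 1] by (auto simp: less_le)
    then show False using nz by (simp add: AE_iff_measurable[OF sets.top])
  qed
  then have "B \<noteq> 0"
    unfolding B_def using int1 by (subst integral_nonneg_eq_0_iff_AE) auto
  moreover have "B \<ge> 0"
    unfolding B_def by simp
  ultimately have "B > 0" by simp
  have Bs: "(LINT x|\<mu>. c * s / norm (join_last x s :: real ^ 'n::{finite,linorder}) ^ CARD('n)) = c * B" if "s > 0" for c s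
  proof -
    have scale: "S s (\<lambda>i\<in>J. s * x i) = s\<^sup>2 * S 1 x" for x
      by (simp add: S_def power_mult_distrib sum_distrib_left distrib_left)
    have "real CARD('n) = real (card J) + 1" using N J by simp
    then have "s powr real CARD('n) = s powr real (card J) * s"
      using \<open>s > 0\<close> by (simp add: powr_add)
    \<comment> \<open>The Jacobian \<open>s^(N-1)\<close> and the factor \<open>s\<close> of the
      integrand cancel \<open>(s^2)^(-N/2)\<close>.\<close>
    then have eq: "s ^ card J * (s * (s\<^sup>2 * S 1 x) powr (-p)) = S 1 x powr (-p)" for x
      using \<open>s > 0\<close> Spos[of 1 x]
      by (simp add: powr_mult powr_powr powr_minus p_def powr_realpow power2_eq_square field_simps powr_add[symmetric])
    have "(\<integral>\<^sup>+x. ennreal (s * S s x powr (-p)) \<partial>\<mu>) =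
        ennreal s ^ card J * (\<integral>\<^sup>+x. ennreal (s * S s (\<lambda>i\<in>J. s * x i) powr (-p)) \<partial>\<mu>)"
      unfolding \<mu>_def
      by (rule nn_integral_PiM_lborel_scale) (use J \<open>s > 0\<close> in \<open>auto simp: \<mu>_def[symmetric]\<close>)
    also have "\<dots> = (\<integral>\<^sup>+x. ennreal s ^ card J * ennreal (s * (s\<^sup>2 * S 1 x) powr (-p)) \<partial>\<mu>)"
      unfolding scale by (rule nn_integral_cmult[symmetric]) measurable
    also have "\<dots> = (\<integral>\<^sup>+x. ennreal (S 1 x powr (-p)) \<partial>\<mu>)"
      by (intro nn_integral_cong) (use \<open>s > 0\<close> in \<open>simp add: ennreal_power ennreal_mult[symmetric] eq\<close>)
    finally have "(LINT x|\<mu>. s * S s x powr (-p)) = B"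
      unfolding B_def using \<open>s > 0\<close>
      by (subst (1 2) integral_eq_nn_integral) (auto simp del: integral_mult_right_zero)
    moreover have "c * s / norm (join_last x s :: real ^ 'n::{finite,linorder}) ^ CARD('n) = c * (s * S s x powr (-p))" for x
    proof -
      have "norm (join_last x s :: real ^ 'n::{finite,linorder}) ^ CARD('n) = S s x powr p"
        unfolding S_def J_def p_def by (rule norm_join_last_power) (use \<open>s > 0\<close> in simp)
      then show ?thesis by (simp only: powr_minus divide_inverse mult.assoc)
    qed
    ultimately show ?thesis by simp
  qed
  have "poisson_const TYPE('n) = (THE c. 0 < c \<and> (\<forall>s>0::real. c * B = 1))"
    unfolding poisson_const_def using Bs unfolding \<mu>_def J_def by (intro arg_cong[of _ _ The]) (auto simp: fun_eq_iff)
  also have "\<dots> = 1 / B"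
    using \<open>B > 0\<close> by (intro the_equality) (auto simp: field_simps intro: exI[of _ 1])
  finally show ?thesis using \<open>B > 0\<close> by simp
qed

subsection \<open>The one-dimensional integral\<close>

text \<open>Every upper bound on the flux goes through this: \<open>g\<close> is an explicit
  derivative, continuous up to the endpoints, while \<open>f\<close> is compared with it only inside
  the open interval.\<close>

lemma set_integral_le_antiderivative:
  fixes f g G :: "real \<Rightarrow> real"
  assumes "a \<le> b" "set_integrable lborel {a<..<b} f"
    and le: "\<And>x. a < x \<Longrightarrow> x < b \<Longrightarrow> f x \<le> g x"
    and der: "\<And>x. a \<le> x \<Longrightarrow> x \<le> b \<Longrightarrow> (G has_real_derivative g x) (at x)"
    and cont: "continuous_on {a..b} g"
  shows "(LBINT x:{a<..<b}. f x) \<le> G b - G a"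
proof -
  have g: "set_integrable lborel {a..b} g"
    by (rule borel_integrable_atLeastAtMost'[OF cont])
  then have "set_integrable lborel {a<..<b} g"
    by (rule set_integrable_subset) auto
  then have "(LBINT x:{a<..<b}. f x) \<le> (LBINT x:{a<..<b}. g x)"
    using assms(2) le by (intro set_integral_mono) auto
  also have "\<dots> = (LBINT x:{a..b}. g x)"
    using interval_integral_Icc[OF assms(1), of g] interval_integral_Ioo[of a b g] assms(1) by simp
  also have "\<dots> = G b - G a"
    unfolding set_lebesgue_integral_def using assms(1)
    by (rule integral_FTC_Icc)
       (use der cont in \<open>auto simp: has_real_derivative_iff_has_vector_derivative[symmetric] intro: DERIV_subset\<close>)
  finally show ?thesis .
qed

text \<open>Counterpart for lower bounds: nonnegativity allows discarding everything outside the
  subinterval that carries the mass.\<close>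

lemma set_integral_ge_on_subinterval:
  fixes f :: "real \<Rightarrow> real"
  assumes "set_integrable lborel {a<..<b} f" "a < u" "u \<le> v" "v < b"
    and nonneg: "\<And>x. a < x \<Longrightarrow> x < b \<Longrightarrow> 0 \<le> f x"
    and ge: "\<And>x. u \<le> x \<Longrightarrow> x \<le> v \<Longrightarrow> L \<le> f x"
  shows "(v - u) * L \<le> (LBINT x:{a<..<b}. f x)"
proof -
  have "(v - u) * L = (LBINT x:{u..v}. L)"
    using assms by (simp add: set_integral_const)
  also have "\<dots> \<le> (LBINT x:{u..v}. f x)"
    by (intro set_integral_mono borel_integrable_atLeastAtMost' continuous_on_const
          set_integrable_subset[OF assms(1)] ge) (use assms in auto)
  also have "\<dots> \<le> (LBINT x:{a<..<b}. f x)"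
    unfolding set_lebesgue_integral_def
  proof (rule integral_mono)
    show "integrable lborel (\<lambda>x. indicator {u..v} x *\<^sub>R f x)"
      using set_integrable_subset[OF assms(1), of "{u..v}"] assms(2,4)
      unfolding set_integrable_def by fastforce
    show "integrable lborel (\<lambda>x. indicator {a<..<b} x *\<^sub>R f x)"
      using assms(1) by (simp add: set_integrable_def)
  qed (use assms in \<open>auto split: split_indicator\<close>)
  finally show ?thesis .
qed

text \<open>Trades Gaussian decay for a power that stays bounded as \<open>s\<close> tends to 0 when
  \<open>v > 0\<close>. With \<open>v = s u\<close> it reduces to
  \<open>1 + u <= 8 q (1 + u / (8 q)) <= 8 q exp (u / (8 q))\<close>, raised to the power
  \<open>q\<close>. The 8 means that only half of an exponent \<open>v / (4 s)\<close> is
  spent.\<close>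

lemma powr_mult_exp_le:
  fixes q s v :: real
  assumes "q \<ge> 1" "s > 0" "v \<ge> 0"
  shows "s powr (-q) * exp (- v / (8 * s)) \<le> (8 * q) powr q * (v + s) powr (-q)"
proof -
  define u where "u = v / s"
  have u: "u \<ge> 0" "v = s * u" using assms by (simp_all add: u_def)
  have "1 + u \<le> 8 * q * (1 + u / (8 * q))" using assms u(1) by (simp add: field_simps)
  also have "\<dots> \<le> 8 * q * exp (u / (8 * q))"
    using assms exp_ge_add_one_self[of "u / (8 * q)"] by (intro mult_left_mono) auto
  finally have "(1 + u) powr q \<le> (8 * q * exp (u / (8 * q))) powr q"
    using assms u(1) by (intro powr_mono2) auto
  also have "\<dots> = (8 * q) powr q * exp (u / 8)"
    using assms by (simp add: powr_mult exp_powr_real)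
  finally have "exp (- (u / 8)) \<le> (8 * q) powr q * (1 + u) powr (-q)"
    using u(1) by (simp add: exp_minus powr_minus field_simps)
  then have "s powr (-q) * exp (- (u / 8)) \<le> s powr (-q) * ((8 * q) powr q * (1 + u) powr (-q))"
    by (intro mult_left_mono) auto
  also have "\<dots> = (8 * q) powr q * (s * (1 + u)) powr (-q)"
    using assms u(1) by (simp add: powr_mult)
  finally show ?thesis
    using assms by (simp add: u(2) algebra_simps)
qed

text \<open>The logarithm of the left side has derivative \<open>v / (4 s^2) - q / s\<close>, which
  is nonnegative for \<open>s <= v / (4 q)\<close>. The inequality
  \<open>ln (t/s) <= t/s - 1\<close> gives the same conclusion without differentiating.\<close>

lemma powr_mult_exp_mono:
  fixes q s t v :: real
  assumes "q \<ge> 0" "0 < s" "s \<le> t" "4 * q*t \<le> v"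
  shows "s powr (-q) * exp (- v / (4 * s)) \<le> t powr (-q) * exp (- v / (4 * t))"
proof -
  have "q * (ln t - ln s) = q * ln (t/s)" using assms by (simp add: ln_div)
  also have "\<dots> \<le> q * (t/s - 1)"
    using assms ln_le_minus_one[of "t/s"] by (intro mult_left_mono) auto
  also have "\<dots> \<le> (v / (4 * t)) * (t/s - 1)"
    using assms by (intro mult_right_mono) (auto simp: field_simps)
  also have "\<dots> = v / (4 * s) - v / (4 * t)"
    using assms by (simp add: field_simps)
  finally have "- q * ln s - v / (4 * s) \<le> - q * ln t - v / (4 * t)"
    by (simp add: algebra_simps)
  moreover have "r powr (-q) * exp (- v / (4 * r)) = exp (- q * ln r - v / (4 * r))" if "r > 0" for r
    using that by (simp add: powr_def mult_exp_exp)
  ultimately show ?thesis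
    using assms by simp
qed

section \<open>The model integral and its integrability\<close>

definition flux_density :: "real \<Rightarrow> real \<Rightarrow> real \<Rightarrow> real \<Rightarrow> real \<Rightarrow> real" where
  "flux_density q w a t \<tau> =
     (a + \<tau>) * (t - \<tau>) powr (-q) * exp (- (w + (a + \<tau>)\<^sup>2) / (4 * (t - \<tau>)))"

definition flux :: "real \<Rightarrow> real \<Rightarrow> real \<Rightarrow> real \<Rightarrow> real" where
  "flux q w a t = (LBINT \<tau>:{0<..<t}. flux_density q w a t \<tau>)"

context
  fixes q w a t :: real
  assumes q: "q > 1" and w: "w \<ge> 0" and a: "a \<ge> 0" and t: "t > 0"
begin

lemma flux_density_nonneg: "0 < \<tau> \<Longrightarrow> 0 \<le> flux_density q w a t \<tau>"
  using a by (simp add: flux_density_def)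

text \<open>With \<open>s = t - \<tau>\<close> and \<open>R = w + (a + t)^2\<close>, expanding
  \<open>(a + t - s)^2\<close> gives the exponent \<open>- R / (4 s) + (a + t) / 2 - s / 4\<close>.
  The middle term becomes the exponential prefactor; half of the first removes the singularity at
  \<open>s = 0\<close> by \<open>powr_mult_exp_le\<close>.\<close>

lemma flux_density_le:
  assumes "0 < \<tau>" "\<tau> < t"
  shows "flux_density q w a t \<tau> \<le>
    (a + t) * exp ((a + t) / 2) * ((8 * q) powr q * (w + (a + t)\<^sup>2 + (t - \<tau>)) powr (-q))"
proof -
  define s where "s = t - \<tau>"
  let ?R = "w + (a + t)\<^sup>2"
  have s: "s > 0" and t_eq: "t = s + \<tau>" using assms by (simp_all add: s_def)
  have "- (w + (a + \<tau>)\<^sup>2) / (4 * s) = - ?R / (4 * s) + (a + t) / 2 - s / 4"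
    unfolding t_eq using s by (simp add: field_simps power2_eq_square)
  also have "\<dots> \<le> (a + t) / 2 + - ?R / (8 * s)"
  proof -
    have "?R / (4 * s) = ?R / (8 * s) + ?R / (8 * s)" by (simp add: field_simps)
    moreover have "0 \<le> ?R / (8 * s)" using s w by simp
    ultimately show ?thesis using s unfolding minus_divide_left[symmetric] by linarith
  qed
  finally have "exp (- (w + (a + \<tau>)\<^sup>2) / (4 * s)) \<le> exp ((a + t) / 2) * exp (- ?R / (8 * s))"
    by (simp flip: exp_add)
  then have "flux_density q w a t \<tau> \<le> (a + t) * s powr (-q) * (exp ((a + t) / 2) * exp (- ?R / (8 * s)))"
    unfolding flux_density_def s_def[symmetric] using assms a by (intro mult_mono) auto
  also have "\<dots> = (a + t) * exp ((a + t) / 2) * (s powr (-q) * exp (- ?R / (8 * s)))"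
    by simp
  also have "\<dots> \<le> (a + t) * exp ((a + t) / 2) * ((8 * q) powr q * (?R + s) powr (-q))"
    using a t w s q by (intro mult_left_mono powr_mult_exp_le) auto
  finally show ?thesis by (simp add: s_def)
qed

text \<open>The pointwise bound stays finite as \<open>\<tau>\<close> approaches \<open>t\<close>
  because \<open>(a + t)^2 > 0\<close>, so the density is bounded on a bounded interval.\<close>

lemma flux_density_integrable: "set_integrable lborel {0<..<t} (flux_density q w a t)"
  unfolding set_integrable_def
proof (rule integrableI_bounded_set)
  let ?B = "(a + t) * exp ((a + t) / 2) * ((8 * q) powr q * ((a + t)\<^sup>2) powr (-q))"
  show "{0<..<t} \<in> sets lborel" by simp
  show "(\<lambda>x. indicator {0<..<t} x *\<^sub>R flux_density q w a t x) \<in> borel_measurable lborel"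
    unfolding flux_density_def by measurable
  show "emeasure lborel {0<..<t} < \<infinity>" using t by simp
  have "norm (flux_density q w a t x) \<le> ?B" if "0 < x" "x < t" for x
  proof -
    have "flux_density q w a t x \<le>
      (a + t) * exp ((a + t) / 2) * ((8 * q) powr q * (w + (a + t)\<^sup>2 + (t - x)) powr (-q))"
      by (rule flux_density_le[OF that])
    also have "\<dots> \<le> ?B"
      using a t w q that by (intro mult_left_mono powr_mono2') auto
    finally show ?thesis using flux_density_nonneg[OF that(1)] by simp
  qed
  then show "AE x in lborel. x \<in> {0<..<t} \<longrightarrow> norm (indicator {0<..<t} x *\<^sub>R flux_density q w a t x) \<le> ?B"
    by auto
qed auto

section \<open>Bounds without a Gaussian factor\<close>

text \<open>Integrates \<open>flux_density_le\<close> exactly and drops the contribution of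
  \<open>\<tau> = 0\<close>. For \<open>q = N/2 + 1\<close> the profile
  \<open>(a + t) (w + (a + t)^2)^(1 - q)\<close> is the Poisson kernel up to a constant.\<close>

lemma flux_le_near:
  "flux q w a t \<le> (a + t) * exp ((a + t) / 2) * ((8 * q) powr q / (q - 1)) * (w + (a + t)\<^sup>2) powr (1 - q)"
proof -
  let ?c = "(a + t) * exp ((a + t) / 2) * (8 * q) powr q" and ?R = "w + (a + t)\<^sup>2"
  let ?G = "\<lambda>\<tau>. ?c / (q - 1) * (?R + (t - \<tau>)) powr (1 - q)"
  have R: "?R > 0" using a t w by (intro add_nonneg_pos) auto
  have "flux q w a t \<le> ?G t - ?G 0"
    unfolding flux_def
  proof (rule set_integral_le_antiderivative[OF _ flux_density_integrable])
    show "flux_density q w a t x \<le> ?c * (?R + (t - x)) powr (-q)" if "0 < x" "x < t" for x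
      using flux_density_le[OF that] by (simp add: mult.assoc)
    show "(?G has_real_derivative ?c * (?R + (t - x)) powr (-q)) (at x)" if "0 \<le> x" "x \<le> t" for x
      by (rule derivative_eq_intros refl | use that R q in \<open>simp add: field_simps\<close>)+
    show "continuous_on {0..t} (\<lambda>x. ?c * (?R + (t - x)) powr (-q))"
      using R by (intro continuous_intros) auto
  qed (use t in auto)
  also have "\<dots> \<le> ?G t"
    using a t q by simp
  finally show ?thesis by (simp add: mult_ac)
qed

text \<open>With \<open>R = w + (a + t)^2\<close>, the mass is taken from \<open>t - \<tau>\<close>
  between \<open>\<delta> R / 2\<close> and \<open>\<delta> R\<close>. There the exponent is at
  least \<open>- 1 / (2 \<delta>)\<close>, and \<open>\<delta> R <= t / 2\<close> keeps
  \<open>\<tau> >= t / 2\<close>, so \<open>a + \<tau>\<close> is at least half of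
  \<open>a + t\<close>.\<close>

lemma flux_ge_near:
  fixes \<delta> :: real
  assumes "\<delta> > 0" "\<delta> * (w + (a + t)\<^sup>2) \<le> t / 2"
  shows "\<delta> powr (1 - q) * exp (- 1 / (2 * \<delta>)) / 4 * ((a + t) * (w + (a + t)\<^sup>2) powr (1 - q)) \<le> flux q w a t"
proof -
  define R where "R = w + (a + t)\<^sup>2"
  have R: "R > 0" unfolding R_def using a t w by (intro add_nonneg_pos) auto
  let ?L = "(a + t) / 2 * (\<delta> * R) powr (-q) * exp (- 1 / (2 * \<delta>))"
  have dR: "0 < \<delta> * R" "\<delta> * R \<le> t / 2" using R assms by (auto simp: R_def)
  have "((t - \<delta> * R / 2) - (t - \<delta> * R)) * ?L \<le> flux q w a t"
    unfolding flux_def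
  proof (rule set_integral_ge_on_subinterval[OF flux_density_integrable])
    fix x assume x: "t - \<delta> * R \<le> x" "x \<le> t - \<delta> * R / 2"
    have *: "0 < x" "x < t" "t / 2 \<le> x" using x dR t by linarith+
    have "(a + x)\<^sup>2 \<le> (a + t)\<^sup>2"
      using a * by (intro power_mono) auto
    then have "(w + (a + x)\<^sup>2) / (4 * (t - x)) \<le> R / (4 * (\<delta> * R / 2))"
      unfolding R_def[symmetric] using x dR a w
      by (intro frac_le) (auto simp: R_def)
    also have "\<dots> = 1 / (2 * \<delta>)" using R assms by (simp add: field_simps)
    finally have e: "exp (- 1 / (2 * \<delta>)) \<le> exp (- (w + (a + x)\<^sup>2) / (4 * (t - x)))"
      unfolding exp_le_cancel_iff minus_divide_left[symmetric] by linarith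
    have p: "(\<delta> * R) powr (-q) \<le> (t - x) powr (-q)"
      using x dR * q by (intro powr_mono2') auto
    show "?L \<le> flux_density q w a t x"
      unfolding flux_density_def using e p a * t
      by (intro mult_mono) auto
  next
    show "0 \<le> flux_density q w a t x" if "0 < x" for x
      using that by (rule flux_density_nonneg)
  qed (use dR t in linarith)+
  moreover have "((t - \<delta> * R / 2) - (t - \<delta> * R)) * ?L =
      (\<delta> * R) powr (1 - q) * exp (- 1 / (2 * \<delta>)) / 4 * (a + t)"
    using dR by (simp add: powr_diff powr_minus field_simps)
  moreover have "\<delta> powr (1 - q) * exp (- 1 / (2 * \<delta>)) / 4 * ((a + t) * R powr (1 - q)) =
      (\<delta> * R) powr (1 - q) * exp (- 1 / (2 * \<delta>)) / 4 * (a + t)"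
    using assms R by (simp add: powr_mult)
  ultimately show ?thesis
    unfolding R_def[symmetric] by linarith
qed

text \<open>The exponent \<open>(a + \<tau>)^2 / (4 s)\<close> is split in halves. One tames
  \<open>s powr (-q)\<close>; the other, weakened to \<open>(a + \<tau>)^2 / (8 t)\<close>, combines
  with \<open>a + \<tau>\<close> into an exact derivative.\<close>

lemma flux_le_intermediate:
  assumes "t \<ge> 4"
  shows "flux q w a t \<le> 4 * (8 * q) powr q * 2 powr q * t powr (1 - q)"
proof -
  let ?c = "(8 * q) powr q * 2 powr q * t powr (-q)"
  let ?G = "\<lambda>\<tau>. - (?c * (4 * t)) * exp (- (a + \<tau>)\<^sup>2 / (8 * t))"
  have "flux q w a t \<le> ?G t - ?G 0"
    unfolding flux_def
  proof (rule set_integral_le_antiderivative[OF _ flux_density_integrable])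
    fix x assume x: "0 < x" "x < t"
    define s where "s = t - x"
    let ?b = "(a + x)\<^sup>2"
    have s: "s > 0" "s \<le> t" using x by (simp_all add: s_def)
    \<comment> \<open>\<open>4 <= t\<close> enters here: either \<open>s >= t / 2\<close>, or
      \<open>x > t / 2\<close> and then \<open>x^2 >= t^2 / 4 >= t\<close>.\<close>
    have "t / 2 \<le> x\<^sup>2 + s"
    proof (cases "x \<le> t / 2")
      case False
      then have "(t / 2) * (t / 2) \<le> x * x" using t by (intro mult_mono) auto
      moreover have "t * 4 \<le> t * t" using assms by (intro mult_left_mono) auto
      ultimately show ?thesis using x unfolding s_def power2_eq_square by linarith
    qed (use zero_le_power2[of x] s_def in linarith)
    also have "x\<^sup>2 \<le> ?b" using a x by (intro power_mono) auto
    finally have "(?b + s) powr (-q) \<le> (t / 2) powr (-q)"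
      using t q s by (intro powr_mono2') auto
    also have "(t / 2) powr (-q) = 2 powr q * t powr (-q)"
      using t by (simp add: powr_divide powr_minus field_simps)
    finally have le: "(?b + s) powr (-q) \<le> 2 powr q * t powr (-q)" .
    have "?b / (4 * s) \<le> (w + ?b) / (4 * s)"
      using s w by (intro divide_right_mono) auto
    moreover have "?b / (4 * s) = ?b / (8 * s) + ?b / (8 * s)"
      using s(1) by (simp add: field_simps)
    moreover have "?b / (8 * t) \<le> ?b / (8 * s)"
      using s by (simp add: frac_le)
    ultimately have "exp (- (w + ?b) / (4 * s)) \<le> exp (- ?b / (8 * s)) * exp (- ?b / (8 * t))"
      unfolding exp_add[symmetric] exp_le_cancel_iff minus_divide_left[symmetric] by linarith
    then have "flux_density q w a t x \<le> (a + x) * s powr (-q) * (exp (- ?b / (8 * s)) * exp (- ?b / (8 * t)))"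
      unfolding flux_density_def s_def[symmetric] using x a by (intro mult_left_mono) auto
    also have "\<dots> = (a + x) * exp (- ?b / (8 * t)) * (s powr (-q) * exp (- ?b / (8 * s)))"
      by simp
    also have "\<dots> \<le> (a + x) * exp (- ?b / (8 * t)) * ((8 * q) powr q * (2 powr q * t powr (-q)))"
      using a x q s by (intro mult_left_mono order_trans[OF powr_mult_exp_le] le) auto
    finally show "flux_density q w a t x \<le> ?c * ((a + x) * exp (- ?b / (8 * t)))"
      by (simp add: mult_ac)
  next
    show "(?G has_real_derivative ?c * ((a + x) * exp (- (a + x)\<^sup>2 / (8 * t)))) (at x)" for x
      by (rule derivative_eq_intros refl | use t in \<open>simp add: field_simps\<close>)+
  qed (use t in \<open>auto intro!: continuous_intros\<close>)
  also have "\<dots> \<le> ?c * (4 * t) * 1"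
  proof -
    have "?c * (4 * t) * exp (- (a + 0)\<^sup>2 / (8 * t)) \<le> ?c * (4 * t) * 1"
      using t by (intro mult_left_mono) auto
    moreover have "0 \<le> ?c * (4 * t) * exp (- (a + t)\<^sup>2 / (8 * t))"
      using t by simp
    ultimately show ?thesis unfolding mult_minus_left by linarith
  qed
  also have "\<dots> = 4 * (8 * q) powr q * 2 powr q * t powr (1 - q)"
    using t by (simp add: powr_diff powr_minus field_simps)
  finally show ?thesis .
qed

section \<open>Bounds with a Gaussian factor\<close>

text \<open>The exponent separates into \<open>w + a^2\<close> and
  \<open>2 a \<tau> + \<tau>^2\<close>. By \<open>powr_mult_exp_mono\<close> the first part together
  with the power is largest at \<open>s = t\<close>; the rest is integrated in two ways, one for
  each entry of the minimum.\<close>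

lemma flux_le_far:
  assumes "4 * q * t \<le> w + a\<^sup>2"
  shows "flux q w a t \<le> min 2 (a + t) * (t powr (1 - q) * exp (- (w + a\<^sup>2) / (4 * t)))"
proof -
  let ?c = "t powr (-q) * exp (- (w + a\<^sup>2) / (4 * t))"
  have bound: "flux_density q w a t x \<le> ?c * ((a + x) * exp (- (2 * a * x + x\<^sup>2) / (4 * t)))"
    if x: "0 < x" "x < t" for x
  proof -
    define s where "s = t - x"
    have s: "s > 0" "s \<le> t" using x by (simp_all add: s_def)
    have "- (w + (a + x)\<^sup>2) / (4 * s) = - (w + a\<^sup>2) / (4 * s) - (2 * a * x + x\<^sup>2) / (4 * s)"
      using s(1) by (simp add: field_simps power2_eq_square)
    also have "\<dots> \<le> - (w + a\<^sup>2) / (4 * s) - (2 * a * x + x\<^sup>2) / (4 * t)"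
      using s x a by (intro diff_left_mono divide_left_mono) auto
    finally have "exp (- (w + (a + x)\<^sup>2) / (4 * s))
        \<le> exp (- (w + a\<^sup>2) / (4 * s)) * exp (- (2 * a * x + x\<^sup>2) / (4 * t))"
      unfolding exp_add[symmetric] exp_le_cancel_iff minus_divide_left[symmetric] by linarith
    then have "flux_density q w a t x \<le> (a + x) * s powr (-q) *
        (exp (- (w + a\<^sup>2) / (4 * s)) * exp (- (2 * a * x + x\<^sup>2) / (4 * t)))"
      unfolding flux_density_def s_def[symmetric] using a x by (intro mult_left_mono) auto
    also have "\<dots> = (a + x) * exp (- (2 * a * x + x\<^sup>2) / (4 * t)) *
        (s powr (-q) * exp (- (w + a\<^sup>2) / (4 * s)))"
      by simp
    also have "\<dots> \<le> (a + x) * exp (- (2 * a * x + x\<^sup>2) / (4 * t)) * ?c"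
      using assms a x q s by (intro mult_left_mono powr_mult_exp_mono) auto
    finally show ?thesis by (simp add: mult_ac)
  qed
  \<comment> \<open>First way: the remaining factor is at most the constant
    \<open>a + t\<close>.\<close>
  have "flux q w a t \<le> ?c * (a + t) * t - ?c * (a + t) * 0"
    unfolding flux_def
  proof (rule set_integral_le_antiderivative[OF _ flux_density_integrable])
    show "flux_density q w a t x \<le> ?c * (a + t)" if x: "0 < x" "x < t" for x
    proof -
      have "0 \<le> (2 * a * x + x\<^sup>2) / (4 * t)" using a x by simp
      then have "exp (- (2 * a * x + x\<^sup>2) / (4 * t)) \<le> 1"
        unfolding exp_le_one_iff minus_divide_left[symmetric] by linarith
      then have "(a + x) * exp (- (2 * a * x + x\<^sup>2) / (4 * t)) \<le> (a + t) * 1"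
        using a x by (intro mult_mono) auto
      then have "?c * ((a + x) * exp (- (2 * a * x + x\<^sup>2) / (4 * t))) \<le> ?c * ((a + t) * 1)"
        by (rule mult_left_mono) simp
      with bound[OF x] show ?thesis by (simp only: mult_1_right)
    qed
    show "((*) (?c * (a + t)) has_real_derivative ?c * (a + t)) (at x)" for x
      by (rule derivative_eq_intros refl | simp)+
  qed (use t in auto)
  then have 1: "flux q w a t \<le> (a + t) * (?c * t)"
    by (simp add: mult_ac)
  \<comment> \<open>Second way: the majorant has this exact antiderivative, whose increment is at
    most \<open>2 t ?c\<close> whatever the size of \<open>a\<close>.\<close>
  let ?G = "\<lambda>x. - (?c * (2 * t)) * exp (- (2 * a * x + x\<^sup>2) / (4 * t))"
  have "flux q w a t \<le> ?G t - ?G 0"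
    unfolding flux_def
  proof (rule set_integral_le_antiderivative[OF _ flux_density_integrable])
    show "(?G has_real_derivative ?c * ((a + x) * exp (- (2 * a * x + x\<^sup>2) / (4 * t)))) (at x)" for x
      by (rule derivative_eq_intros refl | use t in \<open>simp add: field_simps\<close>)+
  qed (use t bound in \<open>auto intro!: continuous_intros\<close>)
  also have "\<dots> \<le> 2 * (?c * t)"
    using t by simp
  finally have 2: "flux q w a t \<le> 2 * (?c * t)" .
  have "?c * t = t powr (1 - q) * exp (- (w + a\<^sup>2) / (4 * t))"
    using t by (simp add: powr_diff powr_minus field_simps)
  then have "flux q w a t \<le> (a + t) * (t powr (1 - q) * exp (- (w + a\<^sup>2) / (4 * t)))"
      "flux q w a t \<le> 2 * (t powr (1 - q) * exp (- (w + a\<^sup>2) / (4 * t)))"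
    using 1 2 by (simp_all only:)
  then show ?thesis unfolding min_def by (cases "2 \<le> a + t") (simp_all only: if_True if_False)
qed

text \<open>Only \<open>\<tau>\<close> between \<open>m / 2\<close> and \<open>m\<close> is kept.
  Since \<open>m <= t / 4\<close>, there \<open>4 (t - \<tau>) >= 3 t\<close>, which is where the
  denominator \<open>3 t\<close> comes from; \<open>C\<close> absorbs the increment
  \<open>2 a \<tau> + \<tau>^2\<close> of the exponent.\<close>

lemma flux_ge_initial:
  assumes m: "0 < m" "m \<le> t / 4" and C: "2 * a * m + m\<^sup>2 \<le> 3 * t * C"
  shows "m / 2 * (a + m / 2) * exp (- C) * (t powr (-q) * exp (- (w + a\<^sup>2) / (3 * t))) \<le> flux q w a t"
proof -
  let ?L = "(a + m / 2) * t powr (-q) * exp (- (w + a\<^sup>2) / (3 * t) - C)"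
  have "(m - m / 2) * ?L \<le> flux q w a t"
    unfolding flux_def
  proof (rule set_integral_ge_on_subinterval[OF flux_density_integrable])
    fix x assume x: "m / 2 \<le> x" "x \<le> m"
    have *: "0 < x" "x < t" "x \<le> t / 4" using x m t by linarith+
    have "2 * a * x + x\<^sup>2 \<le> 2 * a * m + m\<^sup>2"
      using x * a by (intro add_mono mult_left_mono power_mono) auto
    with C have C': "2 * a * x + x\<^sup>2 \<le> 3 * t * C" by linarith
    have "(w + (a + x)\<^sup>2) / (4 * (t - x)) \<le> (w + (a + x)\<^sup>2) / (3 * t)"
      using * w by (intro divide_left_mono) auto
    also have "\<dots> = (w + a\<^sup>2) / (3 * t) + (2 * a * x + x\<^sup>2) / (3 * t)"
      using t by (simp add: field_simps power2_eq_square)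
    also have "(2 * a * x + x\<^sup>2) / (3 * t) \<le> C"
      using C' t by (simp add: field_simps)
    finally have e: "exp (- (w + a\<^sup>2) / (3 * t) - C) \<le> exp (- (w + (a + x)\<^sup>2) / (4 * (t - x)))"
      unfolding exp_le_cancel_iff minus_divide_left[symmetric] by linarith
    have p: "t powr (-q) \<le> (t - x) powr (-q)"
      using * q by (intro powr_mono2') auto
    show "?L \<le> flux_density q w a t x"
      unfolding flux_density_def using e p a * x m by (intro mult_mono) auto
  qed (use m t flux_density_nonneg in auto)
  then show ?thesis by (simp add: exp_diff exp_minus field_simps)
qed

text \<open>\<open>flux_ge_initial\<close> with \<open>m = t / 4\<close> and \<open>C = 1\<close>;
  the 64 is the product of \<open>m / 2 = t / 8\<close> and
  \<open>a + t / 8 >= (a + t) / 8\<close>.\<close>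

lemma flux_ge_far_small:
  assumes "a \<le> 1" "t \<le> 1"
  shows "exp (- 1) / 64 * ((a + t) * (t powr (1 - q) * exp (- (w + a\<^sup>2) / (3 * t)))) \<le> flux q w a t"
proof -
  let ?E = "exp (- (w + a\<^sup>2) / (3 * t))"
  have at: "a * t \<le> 1 * t" using assms t by (intro mult_right_mono) auto
  have tt: "t * t \<le> 1 * t" using assms t by (intro mult_right_mono) auto
  have "2 * a * (t/4) + (t/4)\<^sup>2 = (a * t) / 2 + (t * t) / 16"
    by (simp add: power2_eq_square)
  with at tt t have "2 * a * (t/4) + (t/4)\<^sup>2 \<le> 3 * t * 1"
    by linarith
  then have "t/4 / 2 * (a + t/4 / 2) * exp (- 1) * (t powr (-q) * ?E) \<le> flux q w a t"
    by (intro flux_ge_initial) (use t in auto)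
  moreover have "exp (- 1) / 64 * ((a + t) * (t powr (1 - q) * ?E)) =
      t / 4 / 2 * ((a + t) / 8) * exp (- 1) * (t powr (-q) * ?E)"
    using t by (simp add: powr_diff powr_minus field_simps)
  moreover have "\<dots> \<le> t/4 / 2 * (a + t/4 / 2) * exp (- 1) * (t powr (-q) * ?E)"
    using a t by (intro mult_right_mono mult_left_mono) auto
  ultimately show ?thesis by linarith
qed

text \<open>\<open>flux_ge_initial\<close> with \<open>m = t / (8 (a + sqrt t))\<close> and
  \<open>C = 1\<close>. This \<open>m\<close> is small enough that \<open>a m\<close> and
  \<open>m^2\<close> are at most fixed multiples of \<open>t\<close>, yet large enough that
  \<open>m (a + m)\<close> is at least one.\<close>

lemma flux_ge_far_large:
  assumes "a + t \<ge> 1"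
  shows "exp (- 1) / 1024 * (t powr (1 - q) * exp (- (w + a\<^sup>2) / (3 * t))) \<le> flux q w a t"
proof -
  let ?E = "exp (- (w + a\<^sup>2) / (3 * t))"
  define r where "r = sqrt t"
  have r: "r > 0" "r\<^sup>2 = t" using t by (auto simp: r_def)
  define m where "m = t / (8 * (a + r))"
  \<comment> \<open>Yields \<open>m <= t / 4\<close>: either \<open>a >= 1/2\<close>, or
    \<open>t >= 1/2\<close> and hence \<open>sqrt t >= 1/2\<close>.\<close>
  have "1/2 \<le> a + r"
  proof (cases "a \<ge> 1/2")
    case False
    then have "(1/2)\<^sup>2 \<le> r\<^sup>2"
      unfolding r(2) using assms by (simp add: power2_eq_square)
    then have "1/2 \<le> r"
      by (rule power2_le_imp_le) (use r in simp)
    then show ?thesis using a by simp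
  qed (use r in simp)
  then have m4: "m \<le> t / 4" unfolding m_def using t a r by (intro divide_left_mono) auto
  have m0: "m > 0" unfolding m_def using t a r by (intro divide_pos_pos) auto
  have am: "8 * (a * m) + 8 * (r * m) = t"
  proof -
    have "m * (8 * (a + r)) = t" unfolding m_def using a r by simp
    then show ?thesis by (simp add: algebra_simps)
  qed
  have "0 \<le> a * m" using a m0 by simp
  have "r * (8 * m) \<le> r * r" using am \<open>0 \<le> a * m\<close> r by (simp add: power2_eq_square)
  then have "8 * m \<le> r" using r by simp
  then have "m * m \<le> (r / 8) * (r / 8)" using m0 by (intro mult_mono) auto
  then have mm: "m * m \<le> t / 64" using r by (simp add: power2_eq_square)
  have "2 * a * m + m\<^sup>2 \<le> 3 * t * 1"
    using am mm t mult_pos_pos[OF r(1) m0] \<open>0 \<le> a * m\<close> by (simp add: power2_eq_square)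
  then have "m / 2 * (a + m / 2) * exp (- 1) * (t powr (-q) * ?E) \<le> flux q w a t"
    by (rule flux_ge_initial[OF m0 m4])
  \<comment> \<open>If \<open>sqrt t <= a\<close>, then \<open>a m >= t / 16\<close>. Otherwise
    \<open>m >= sqrt t / 16\<close>, so \<open>m^2 / 4 >= t / 1024\<close>, which fixes the
    constant.\<close>
  moreover have "t / 1024 \<le> m / 2 * (a + m / 2)"
  proof (cases "r \<le> a")
    case True
    then have "r * m \<le> a * m" using m0 by simp
    then have "t / 16 \<le> a * m" using am by linarith
    moreover have "m / 2 * (a + m / 2) = a * m / 2 + m * m / 4" by (simp add: field_simps)
    ultimately show ?thesis using m0 t mult_pos_pos[OF m0 m0] by linarith
  next
    case False
    then have "a * m \<le> r * m" using m0 by simp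
    then have "r * r \<le> r * (16 * m)" using am r by (simp add: power2_eq_square)
    then have "r \<le> 16 * m" using r by simp
    then have "r * r \<le> (16 * m) * (16 * m)" using r by (intro mult_mono) auto
    then have "t \<le> 256 * (m * m)" using r by (simp add: power2_eq_square)
    moreover have "m / 2 * (a + m / 2) = a * m / 2 + m * m / 4" by (simp add: field_simps)
    ultimately show ?thesis using \<open>0 \<le> a * m\<close> by linarith
  qed
  then have "t / 1024 * exp (- 1) * (t powr (-q) * ?E) \<le> m / 2 * (a + m / 2) * exp (- 1) * (t powr (-q) * ?E)"
    by (intro mult_right_mono) auto
  moreover have "exp (- 1) / 1024 * (t powr (1 - q) * ?E) = t / 1024 * exp (- 1) * (t powr (-q) * ?E)"
    using t by (simp add: powr_diff powr_minus field_simps)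
  ultimately show ?thesis by linarith
qed

end

subsection \<open>Comparison with the kernels\<close>

lemma e_last_nth [simp]: "lastc (e_last :: real ^ 'n::{finite,linorder}) = 1"
  by (simp add: e_last_def axis_def)

lemma norm_add_e_last_square:
  fixes z :: "real ^ 'n::{finite,linorder}"
  shows "(norm (z + s *\<^sub>R e_last))\<^sup>2 = (norm z)\<^sup>2 + 2 * s * lastc z + s\<^sup>2"
proof -
  have inner_e: "v \<bullet> e_last = lastc v" for v :: "real ^ 'n::{finite,linorder}"
    by (simp add: e_last_def inner_axis)
  show ?thesis
    unfolding power2_norm_eq_inner
    by (simp add: inner_add_left inner_add_right inner_commute[of e_last] inner_e
          power2_eq_square algebra_simps)
qed

lemma lastc_square_le_norm_square:
  fixes z :: "real ^ 'n::{finite,linorder}"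
  shows "(lastc z)\<^sup>2 \<le> (norm z)\<^sup>2"
  using component_le_norm_cart[of z last_ix] by (metis abs_ge_zero power2_abs power_mono)

lemma partial_last_heat_kernel:
  fixes z :: "real ^ 'n::{finite,linorder}"
  assumes "t > 0"
  shows "partial_last heat_kernel z t = - lastc z / (2 * t) * heat_kernel z t"
  unfolding partial_last_def heat_kernel_def norm_add_e_last_square
  by (rule DERIV_imp_deriv)
     (rule derivative_eq_intros refl | use assms in \<open>simp add: field_simps\<close>)+

lemma heat_kernel_eq:
  fixes z :: "real ^ 'n::{finite,linorder}"
  assumes "t > 0"
  shows "heat_kernel z t = (4 * pi) powr (- real CARD('n) / 2) *
    (t powr (1 - (real CARD('n) / 2 + 1)) * exp (- (norm z)\<^sup>2 / (4 * t)))"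
  using assms by (simp add: heat_kernel_def powr_mult)

text \<open>The spatial derivative contributes \<open>- (a + \<tau>) / (2 (t - \<tau>))\<close>; the
  2 cancels and the extra \<open>1 / (t - \<tau>)\<close> raises the power from \<open>N/2\<close>
  to \<open>N/2 + 1\<close>.\<close>

lemma H_eq_flux:
  fixes x y :: "real ^ 'n::{finite,linorder}"
  defines "z \<equiv> x - reflect y"
  shows "H x y t = (4 * pi) powr (- real CARD('n) / 2) *
    flux (real CARD('n) / 2 + 1) ((norm z)\<^sup>2 - (lastc z)\<^sup>2) (lastc z) t"
proof -
  let ?k = "(4 * pi) powr (- real CARD('n) / 2)"
  let ?f = "flux_density (real CARD('n) / 2 + 1) ((norm z)\<^sup>2 - (lastc z)\<^sup>2) (lastc z) t"
  have *: "- 2 * partial_last heat_kernel (z + \<tau> *\<^sub>R e_last) (t - \<tau>) = ?k * ?f \<tau>"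
    if "\<tau> < t" for \<tau>
  proof -
    define s where "s = t - \<tau>"
    have s: "s > 0" using that by (simp add: s_def)
    have n: "(norm (z + \<tau> *\<^sub>R e_last))\<^sup>2 = (norm z)\<^sup>2 - (lastc z)\<^sup>2 + (lastc z + \<tau>)\<^sup>2"
      unfolding norm_add_e_last_square by (simp add: power2_eq_square algebra_simps)
    have pw: "s powr (- (real CARD('n) / 2 + 1)) = s powr (1 - (real CARD('n) / 2 + 1)) / s"
      using s by (simp add: powr_diff powr_minus powr_add)
    have lc: "lastc (z + \<tau> *\<^sub>R e_last) = lastc z + \<tau>" by simp
    \<comment> \<open>Proved for arbitrary reals so that the unfolded goal is literally an
      instance.\<close>
    have "- 2 * (- b / (2 * s) * (m * (p * e))) = m * (b * (p / s) * e)" for b m p e :: real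
      using s by simp
    then show ?thesis
      unfolding partial_last_heat_kernel[OF s, unfolded s_def] flux_density_def
        heat_kernel_eq[OF s, unfolded s_def] n
      unfolding s_def[symmetric] pw lc .
  qed
  have "H x y t = (LBINT \<tau>:{0<..<t}. - 2 * partial_last heat_kernel (z + \<tau> *\<^sub>R e_last) (t - \<tau>))"
    unfolding H_def z_def by (simp only: set_integral_mult_right)
  also have "\<dots> = (LBINT \<tau>:{0<..<t}. ?k * ?f \<tau>)"
    by (rule set_lebesgue_integral_cong) (use * in auto)
  finally show ?thesis
    by (simp add: flux_def)
qed

text \<open>For \<open>N = 1\<close> the kernel is the constant \<open>1 = (x\<^sub>N + t) * \<bar>x + t e\<^sub>N\<bar> powr (- N)\<close>, so both cases
  of its definition have the same shape.\<close>

definition poisson_weight :: "'n::{finite,linorder} itself \<Rightarrow> real" where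
  "poisson_weight _ = (if CARD('n) = 1 then 1 else poisson_const TYPE('n))"

lemma poisson_weight_pos: "poisson_weight TYPE('n::{finite,linorder}) > 0"
  using poisson_const_pos by (auto simp: poisson_weight_def)

lemma norm_eq_lastc:
  fixes z :: "real ^ 'n::{finite,linorder}"
  assumes "CARD('n) = 1"
  shows "norm z = \<bar>lastc z\<bar>"
proof -
  obtain i :: 'n where "UNIV = {i}" using assms by (auto simp: card_1_singleton_iff)
  then have "UNIV = {last_ix :: 'n}" by (metis UNIV_I singletonD)
  then have "(\<Sum>i\<in>UNIV. (norm (z $ i))\<^sup>2) = (\<Sum>i\<in>{last_ix}. (norm (z $ i))\<^sup>2)"
    by (rule arg_cong)
  then show ?thesis
    by (simp add: norm_vec_def L2_set_def)
qed

text \<open>The base of the power is the square of \<open>r = norm (z + t *\<^sub>R e_last)\<close>,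
  so the power is \<open>r^(-N)\<close>. In dimension one \<open>r = lastc z + t\<close> and the
  product collapses to 1.\<close>

lemma poisson_kernel_eq:
  fixes z :: "real ^ 'n::{finite,linorder}"
  assumes "t > 0" "lastc z \<ge> 0"
  shows "poisson_kernel z t = poisson_weight TYPE('n) * ((lastc z + t) *
    ((norm z)\<^sup>2 - (lastc z)\<^sup>2 + (lastc z + t)\<^sup>2) powr (1 - (real CARD('n) / 2 + 1)))"
proof -
  define r where "r = norm (z + t *\<^sub>R e_last)"
  have lc: "lastc (z + t *\<^sub>R e_last) = lastc z + t" by simp
  have r: "r > 0"
    using lc assms unfolding r_def by (metis add_nonneg_pos less_irrefl zero_index zero_less_norm_iff)
  have "r\<^sup>2 = (norm z)\<^sup>2 - (lastc z)\<^sup>2 + (lastc z + t)\<^sup>2"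
    unfolding r_def norm_add_e_last_square by (simp add: power2_eq_square algebra_simps)
  then have "(norm z)\<^sup>2 - (lastc z)\<^sup>2 + (lastc z + t)\<^sup>2 = r powr 2"
    using r by simp
  moreover have "1 - (real CARD('n) / 2 + 1) = - (real CARD('n) / 2)"
    by simp
  ultimately have "((norm z)\<^sup>2 - (lastc z)\<^sup>2 + (lastc z + t)\<^sup>2) powr (1 - (real CARD('n) / 2 + 1))
      = (r powr 2) powr (- (real CARD('n) / 2))"
    by (simp only:)
  also have "\<dots> = 1 / r ^ CARD('n)"
    unfolding powr_powr using r by (simp add: powr_minus_divide powr_realpow)
  finally have eq: "((norm z)\<^sup>2 - (lastc z)\<^sup>2 + (lastc z + t)\<^sup>2) powr (1 - (real CARD('n) / 2 + 1))
      = 1 / r ^ CARD('n)" .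
  show ?thesis
  proof (cases "CARD('n) = 1")
    case True
    then have "r = lastc z + t"
      using norm_eq_lastc[OF True, of "z + t *\<^sub>R e_last"] lc assms by (simp add: r_def)
    then show ?thesis
      unfolding eq poisson_kernel_def poisson_weight_def using True r by simp
  next
    case False
    then show ?thesis
      unfolding eq poisson_kernel_def poisson_weight_def r_def by simp
  qed
qed

lemma D_cases:
  fixes x y :: "real ^ 'n::{finite,linorder}"
  assumes "(x, y, t) \<in> D"
  shows "0 < t" "0 \<le> lastc x" "0 \<le> lastc y" "lastc (x - reflect y) = lastc x + lastc y"
proof -
  have "closure Omega \<subseteq> {x :: real ^ 'n::{finite,linorder}. 0 \<le> lastc x}"
    by (rule closure_minimal) (auto simp: Omega_def intro!: closed_Collect_le continuous_intros)
  then show "0 < t" "0 \<le> lastc x" "0 \<le> lastc y"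
    using assms by (auto simp: D_def)
  show "lastc (x - reflect y) = lastc x + lastc y"
    by (simp add: reflect_def)
qed

section \<open>Assembling the bounds over the four regions\<close>

text \<open>Nonnegativity of \<open>H_upper\<close> is part of the claim because it allows each
  region's constant to be enlarged to a common one.\<close>

lemma H_le_H_upper:
  "\<exists>U>0. \<forall>(x :: real ^ 'n::{finite,linorder}) y t. (x, y, t) \<in> D \<longrightarrow>
     0 \<le> H_upper x y t \<and> H x y t \<le> U * H_upper x y t"
proof -
  define q where "q = real CARD('n) / 2 + 1"
  define k where "k = (4 * pi) powr (- real CARD('n) / 2)"
  define c where "c = poisson_weight TYPE('n)"
  define U1 where "U1 = k * exp (7 * q) * ((8 * q) powr q / (q - 1)) / c"
  define U2 where "U2 = 4 * (8 * q) powr q * 2 powr q * exp q"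
  have q: "q > 1" by (simp add: q_def)
  have k: "k > 0" by (simp add: k_def)
  have c: "c > 0" unfolding c_def by (rule poisson_weight_pos)
  have U: "U1 > 0" "U2 > 0" using q k c by (simp_all add: U1_def U2_def)
  have "0 \<le> H_upper x y t \<and> H x y t \<le> (U1 + U2 + 2) * H_upper x y t"
    if xyt: "(x, y, t) \<in> D" for x y :: "real ^ 'n::{finite,linorder}" and t
  proof -
    define z where "z = x - reflect y"
    define a where "a = lastc z"
    define w where "w = (norm z)\<^sup>2 - a\<^sup>2"
    have t: "t > 0" and a: "a \<ge> 0" and a_eq: "a = lastc x + lastc y"
      using D_cases[OF xyt] by (auto simp: a_def z_def)
    have w: "w \<ge> 0" and wa: "w + a\<^sup>2 = (norm z)\<^sup>2"
      using lastc_square_le_norm_square[of z] by (auto simp: w_def a_def)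
    have H: "H x y t = k * flux q w a t"
      unfolding H_eq_flux k_def q_def w_def a_def z_def ..
    have heat: "heat_kernel z t = k * (t powr (1 - q) * exp (- (norm z)\<^sup>2 / (4 * t)))"
      unfolding k_def q_def by (rule heat_kernel_eq[OF t])
    have poisson: "poisson_kernel z t = c * ((a + t) * (w + (a + t)\<^sup>2) powr (1 - q))"
      unfolding c_def q_def w_def using t a unfolding a_def by (rule poisson_kernel_eq)
    \<comment> \<open>The region threshold \<open>2 (N + 2)\<close> is exactly the
      \<open>4 q\<close> of \<open>powr_mult_exp_mono\<close>.\<close>
    have cond: "2 * (real CARD('n) + 2) = 4 * q" "4 * (real CARD('n) + 2) = 8 * q"
      by (simp_all add: q_def)
    have pos: "0 \<le> heat_kernel z t" "0 \<le> poisson_kernel z t"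
      unfolding heat poisson using k c a t by auto
    consider "(norm z)\<^sup>2 < 4 * q * t" "t < 8 * q" | "(norm z)\<^sup>2 < 4 * q * t" "t \<ge> 8 * q"
      | "(norm z)\<^sup>2 \<ge> 4 * q * t" "a + t < 1" | "(norm z)\<^sup>2 \<ge> 4 * q * t" "a + t \<ge> 1"
      by linarith
    then obtain u where "0 \<le> H_upper x y t" "u \<le> U1 + U2 + 2" "H x y t \<le> u * H_upper x y t"
    proof cases
      case 1
      then have eq: "H_upper x y t = poisson_kernel z t"
        using xyt unfolding H_upper_def D1_def D2_def D3_def D4_def cond z_def a_eq by auto
      \<comment> \<open>Here \<open>a^2 <= 32 q^2 <= (6 q)^2\<close>; with \<open>t < 8 q\<close>
        this explains \<open>exp (7 * q)\<close> in \<open>U1\<close>.\<close>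
      have "a\<^sup>2 \<le> 4 * q * t" using 1 wa w by linarith
      also have "4 * q * t \<le> 4 * q * (8 * q)" using 1 q by (intro mult_left_mono) auto
      also have "\<dots> \<le> (6 * q)\<^sup>2" by (simp add: power2_eq_square)
      finally have "a \<le> 6 * q" by (rule power2_le_imp_le) (use q in simp)
      with 1 have "exp ((a + t) / 2) \<le> exp (7 * q)" by simp
      then have "(a + t) * exp ((a + t) / 2) * ((8 * q) powr q / (q - 1)) * (w + (a + t)\<^sup>2) powr (1 - q)
          \<le> (a + t) * exp (7 * q) * ((8 * q) powr q / (q - 1)) * (w + (a + t)\<^sup>2) powr (1 - q)"
        using a t q by (intro mult_right_mono mult_left_mono) auto
      with flux_le_near[OF q w a t]
      have "H x y t \<le> k * ((a + t) * exp (7 * q) * ((8 * q) powr q / (q - 1)) * (w + (a + t)\<^sup>2) powr (1 - q))"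
        unfolding H using k by (intro mult_left_mono) auto
      also have "\<dots> = U1 * H_upper x y t"
        unfolding eq poisson U1_def using c by simp
      finally show thesis using that[of U1] pos U eq by auto
    next
      case 2
      then have eq: "H_upper x y t = heat_kernel z t"
        using xyt unfolding H_upper_def D1_def D2_def D3_def D4_def cond z_def a_eq by auto
      \<comment> \<open>The Gaussian is at least \<open>exp (- q)\<close> here, so inserting it into
        the bound costs the factor \<open>exp q\<close> of \<open>U2\<close>.\<close>
      have "(norm z)\<^sup>2 / (4 * t) \<le> q" using 2 t by (simp add: field_simps)
      then have "exp (- q) \<le> exp (- (norm z)\<^sup>2 / (4 * t))"
        unfolding exp_le_cancel_iff minus_divide_left[symmetric] by linarith
      then have "exp q * exp (- q) \<le> exp q * exp (- (norm z)\<^sup>2 / (4 * t))"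
        by (intro mult_left_mono) auto
      then have e: "1 \<le> exp q * exp (- (norm z)\<^sup>2 / (4 * t))"
        by (simp add: exp_minus)
      have "4 \<le> t" using 2 q by simp
      have "H x y t \<le> k * (4 * (8 * q) powr q * 2 powr q * t powr (1 - q) * 1)"
        unfolding H using flux_le_intermediate[OF q w a t \<open>4 \<le> t\<close>] k by simp
      also have "\<dots> \<le> k * (4 * (8 * q) powr q * 2 powr q * t powr (1 - q) * (exp q * exp (- (norm z)\<^sup>2 / (4 * t))))"
        using k e by (intro mult_left_mono) auto
      also have "\<dots> = U2 * H_upper x y t"
        unfolding eq heat U2_def by (simp only: mult_ac)
      finally show thesis using that[of U2] pos U eq by auto
    next
      case 3
      then have eq: "H_upper x y t = (a + t) * heat_kernel z t"
        using xyt unfolding H_upper_def D1_def D2_def D3_def D4_def cond z_def a_eq by auto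
      have "H x y t \<le> k * (min 2 (a + t) * (t powr (1 - q) * exp (- (norm z)\<^sup>2 / (4 * t))))"
        unfolding H using flux_le_far[OF q w a t] 3 k unfolding wa by (intro mult_left_mono) auto
      also have "\<dots> \<le> k * ((a + t) * (t powr (1 - q) * exp (- (norm z)\<^sup>2 / (4 * t))))"
        using k by (intro mult_left_mono mult_right_mono) auto
      also have "\<dots> = 1 * H_upper x y t"
        unfolding eq heat by (simp only: mult_ac mult_1)
      finally show thesis using that[of 1] pos U eq a t by auto
    next
      case 4
      then have eq: "H_upper x y t = heat_kernel z t"
        using xyt unfolding H_upper_def D1_def D2_def D3_def D4_def cond z_def a_eq by auto
      have "H x y t \<le> k * (min 2 (a + t) * (t powr (1 - q) * exp (- (norm z)\<^sup>2 / (4 * t))))"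
        unfolding H using flux_le_far[OF q w a t] 4 k unfolding wa by (intro mult_left_mono) auto
      also have "\<dots> \<le> k * (2 * (t powr (1 - q) * exp (- (norm z)\<^sup>2 / (4 * t))))"
        using k by (intro mult_left_mono mult_right_mono) auto
      also have "\<dots> = 2 * H_upper x y t"
        unfolding eq heat by (simp only: mult_ac)
      finally show thesis using that[of 2] pos U eq by auto
    qed
    then show ?thesis
      by (meson mult_right_mono order_trans)
  qed
  then show ?thesis
    using U by (intro exI[of _ "U1 + U2 + 2"]) auto
qed

lemma H_lower_le_H:
  "\<exists>V>0. \<forall>(x :: real ^ 'n::{finite,linorder}) y t. (x, y, t) \<in> D \<longrightarrow>
     0 \<le> H x y t \<and> H_lower x y t \<le> V * H x y t"
proof -
  define q where "q = real CARD('n) / 2 + 1"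
  define k where "k = (4 * pi) powr (- real CARD('n) / 2)"
  define c where "c = poisson_weight TYPE('n)"
  \<comment> \<open>On \<open>D1\<close>, \<open>w + (a + t)^2 <= 24 q t\<close>, and this value
    makes \<open>\<delta>\<close> times that bound equal to \<open>t / 2\<close>, as
    \<open>flux_ge_near\<close> requires.\<close>
  define \<delta> where "\<delta> = 1 / (48 * q)"
  define V1 where "V1 = c / (k * (\<delta> powr (1 - q) * exp (- 1 / (2 * \<delta>)) / 4))"
  define V2 where "V2 = 1024 * exp 1 * 2 powr (q - 1)"
  have q: "q > 1" by (simp add: q_def)
  have k: "k > 0" by (simp add: k_def)
  have c: "c > 0" unfolding c_def by (rule poisson_weight_pos)
  have d: "\<delta> > 0" using q by (simp add: \<delta>_def)
  have V: "V1 > 0" "V2 > 0" using q k c d by (simp_all add: V1_def V2_def)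
  have "0 \<le> H x y t \<and> H_lower x y t \<le> (V1 + V2) * H x y t"
    if xyt: "(x, y, t) \<in> D" for x y :: "real ^ 'n::{finite,linorder}" and t
  proof -
    define z where "z = x - reflect y"
    define a where "a = lastc z"
    define w where "w = (norm z)\<^sup>2 - a\<^sup>2"
    have t: "t > 0" and a: "a \<ge> 0" and a_eq: "a = lastc x + lastc y"
      using D_cases[OF xyt] by (auto simp: a_def z_def)
    have w: "w \<ge> 0" and wa: "w + a\<^sup>2 = (norm z)\<^sup>2"
      using lastc_square_le_norm_square[of z] by (auto simp: w_def a_def)
    have H: "H x y t = k * flux q w a t"
      unfolding H_eq_flux k_def q_def w_def a_def z_def ..
    have poisson: "poisson_kernel z t = c * ((a + t) * (w + (a + t)\<^sup>2) powr (1 - q))"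
      unfolding c_def q_def w_def using t a unfolding a_def by (rule poisson_kernel_eq)
    let ?E = "t powr (1 - q) * exp (- (norm z)\<^sup>2 / (3 * t))"
    \<comment> \<open>Halving the time changes the denominator \<open>4 t\<close> to
      \<open>2 t\<close>, which decays faster than the \<open>3 t\<close> of the flux bounds; the
      prefactor loses only a power of 2.\<close>
    have heat: "heat_kernel z (t / 2) \<le> k * (2 powr (q - 1) * ?E)"
    proof -
      have "heat_kernel z (t / 2) = k * ((t / 2) powr (1 - q) * exp (- (norm z)\<^sup>2 / (4 * (t / 2))))"
        unfolding k_def q_def by (rule heat_kernel_eq) (use t in simp)
      moreover have "(t / 2) powr (1 - q) = 2 powr (q - 1) * t powr (1 - q)"
        using t by (simp add: powr_divide powr_diff field_simps)
      moreover have "(norm z)\<^sup>2 / (3 * t) \<le> (norm z)\<^sup>2 / (4 * (t / 2))"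
        using t by (intro divide_left_mono) auto
      then have "exp (- (norm z)\<^sup>2 / (4 * (t / 2))) \<le> exp (- (norm z)\<^sup>2 / (3 * t))"
        unfolding exp_le_cancel_iff minus_divide_left[symmetric] by linarith
      ultimately show ?thesis
        using k by (simp only: mult.assoc) (intro mult_left_mono; simp)
    qed
    have cond: "2 * (real CARD('n) + 2) = 4 * q" "4 * (real CARD('n) + 2) = 8 * q"
      by (simp_all add: q_def)
    have flux0: "0 \<le> flux q w a t"
      unfolding flux_def set_lebesgue_integral_def
      by (intro integral_nonneg_AE AE_I2) (auto simp: flux_density_nonneg[OF q w a t] split: split_indicator)
    then have H0: "0 \<le> H x y t" unfolding H using k by simp
    \<comment> \<open>\<open>D2\<close> and \<open>D4\<close> share one case: both force
      \<open>a + t >= 1\<close>, in \<open>D2\<close> because \<open>t >= 8 q\<close>.\<close>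
    consider "(norm z)\<^sup>2 < 4 * q * t" "t < 8 * q"
      | "(norm z)\<^sup>2 \<ge> 4 * q * t" "a + t < 1"
      | "(norm z)\<^sup>2 < 4 * q * t \<and> t \<ge> 8 * q \<or> (norm z)\<^sup>2 \<ge> 4 * q * t \<and> a + t \<ge> 1"
      by linarith
    then obtain v where "v \<le> V1 + V2" "H_lower x y t \<le> v * H x y t"
    proof cases
      case 1
      then have eq: "H_lower x y t = poisson_kernel z t"
        using xyt unfolding H_lower_def D1_def D2_def D3_def D4_def cond z_def a_eq by auto
      have "w + (a + t)\<^sup>2 \<le> 2 * (norm z)\<^sup>2 + 2 * t\<^sup>2"
        unfolding wa[symmetric] using w zero_le_power2[of "a - t"] by (simp add: power2_eq_square algebra_simps)
      also have "t\<^sup>2 \<le> 8 * q * t"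
        unfolding power2_eq_square using 1 t by (intro mult_right_mono) auto
      also have "(norm z)\<^sup>2 \<le> 4 * q * t"
        using 1 by simp
      finally have "w + (a + t)\<^sup>2 \<le> 24 * q * t"
        by simp
      then have "\<delta> * (w + (a + t)\<^sup>2) \<le> t / 2"
        unfolding \<delta>_def using q by (simp add: field_simps)
      from flux_ge_near[OF q w a t d this]
      have "V1 * (k * (\<delta> powr (1 - q) * exp (- 1 / (2 * \<delta>)) / 4 * ((a + t) * (w + (a + t)\<^sup>2) powr (1 - q))))
          \<le> V1 * (k * flux q w a t)"
        using V k by (intro mult_left_mono) auto
      then have "H_lower x y t \<le> V1 * H x y t"
        unfolding eq poisson H V1_def using k d by simp
      then show thesis using that[of V1] V by simp
    next
      case 2
      then have eq: "H_lower x y t = (a + t) * heat_kernel z (t / 2)"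
        using xyt unfolding H_lower_def D1_def D2_def D3_def D4_def cond z_def a_eq by auto
      have "exp (- 1) / 64 * ((a + t) * ?E) \<le> flux q w a t"
        using flux_ge_far_small[OF q w a t] 2 a t unfolding wa by simp
      then have "V2 * (k * (exp (- 1) / 64 * ((a + t) * ?E))) \<le> V2 * H x y t"
        unfolding H using V k by (intro mult_left_mono) auto
      \<comment> \<open>\<open>V2\<close> is tuned to the constant 1024 of the other case, which
        leaves a spare factor \<open>1024 / 64 = 16\<close>.\<close>
      moreover have "V2 * (k * (exp (- 1) / 64 * ((a + t) * ?E))) = 16 * ((a + t) * (k * (2 powr (q - 1) * ?E)))"
        unfolding V2_def by (simp add: exp_minus)
      moreover have "(a + t) * heat_kernel z (t / 2) \<le> (a + t) * (k * (2 powr (q - 1) * ?E))"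
        using heat a t by (intro mult_left_mono) auto
      moreover have "0 \<le> (a + t) * (k * (2 powr (q - 1) * ?E))"
        using a t k by (intro mult_nonneg_nonneg) auto
      ultimately have "H_lower x y t \<le> V2 * H x y t"
        unfolding eq by linarith
      then show thesis using that[of V2] V by simp
    next
      case 3
      then have eq: "H_lower x y t = heat_kernel z (t / 2)"
        using xyt unfolding H_lower_def D1_def D2_def D3_def D4_def cond z_def a_eq by auto
      have "1 \<le> a + t" using 3 q a by auto
      then have "exp (- 1) / 1024 * ?E \<le> flux q w a t"
        using flux_ge_far_large[OF q w a t] unfolding wa by simp
      then have "V2 * (k * (exp (- 1) / 1024 * ?E)) \<le> V2 * H x y t"
        unfolding H using V k by (intro mult_left_mono) auto
      moreover have "V2 * (k * (exp (- 1) / 1024 * ?E)) = k * (2 powr (q - 1) * ?E)"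
        unfolding V2_def by (simp add: exp_minus)
      ultimately have "H_lower x y t \<le> V2 * H x y t"
        unfolding eq using heat by linarith
      then show thesis using that[of V2] V by simp
    qed
    then show ?thesis
      using H0 by (meson mult_right_mono order_trans)
  qed
  then show ?thesis
    using V by (intro exI[of _ "V1 + V2"]) auto
qed

theorem theorem1p2:
  "\<exists>C>0. \<forall>(x :: real ^ 'n::{finite,linorder}) y t. (x, y, t) \<in> D \<longrightarrow>
     inverse C * H_lower x y t \<le> H x y t \<and> H x y t \<le> C * H_upper x y t"
proof -
  obtain U where U: "U > 0" "\<And>(x :: real ^ 'n::{finite,linorder}) y t. (x, y, t) \<in> D \<Longrightarrow>
      0 \<le> H_upper x y t \<and> H x y t \<le> U * H_upper x y t"
    using H_le_H_upper by blast
  obtain V where V: "V > 0" "\<And>(x :: real ^ 'n::{finite,linorder}) y t. (x, y, t) \<in> D \<Longrightarrow>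
      0 \<le> H x y t \<and> H_lower x y t \<le> V * H x y t"
    using H_lower_le_H by blast
  \<comment> \<open>One constant serves both sides, since \<open>H_upper\<close> and
    \<open>H\<close> are nonnegative on \<open>D\<close>.\<close>
  have "inverse (U + V) * H_lower x y t \<le> H x y t \<and> H x y t \<le> (U + V) * H_upper x y t"
    if "(x, y, t) \<in> D" for x y :: "real ^ 'n::{finite,linorder}" and t
  proof
    have "H x y t \<le> U * H_upper x y t" "U * H_upper x y t \<le> (U + V) * H_upper x y t"
      using U(2)[OF that] V(1) by (auto intro: mult_right_mono)
    then show "H x y t \<le> (U + V) * H_upper x y t" by linarith
    have "H_lower x y t \<le> V * H x y t" "V * H x y t \<le> (U + V) * H x y t"
      using V(2)[OF that] U(1) by (auto intro: mult_right_mono)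
    then have "H_lower x y t \<le> (U + V) * H x y t" by linarith
    then show "inverse (U + V) * H_lower x y t \<le> H x y t"
      using U(1) V(1) by (simp add: field_simps)
  qed
  then show ?thesis
    using U(1) V(1) by (intro exI[of _ "U + V"]) auto
qed

end
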